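(* Let $w$ and $w'$ be two Dyck paths in $\mathscr{D}_n$ such that $w\leq w'$ in the dexter order. Then $w$ is smaller than (or equal to) $w'$ in the Tamari order on $\mathscr{D}_n$.
   Context: A Dyck path of size $n\geq 0$ is a word of length $2n$ in the letters $0,1$ with $n$ letters $1$ and $n$ letters $0$ such that every prefix contains at least as many $1$'s as $0$'s (the height after a prefix is its number of $1$'s minus its number of $0$'s). Let $\mathscr{D}_n$ be the set of Dyck paths of size $n$. A subpath of a Dyck path $w$ is a non-empty sequence $x$ of consecutive letters of $w$ that starts and ends at the same height and stays strictly above that height in between. A subpath $x$ is movable in $w$ if it is immediately preceded in $w$ by the letter $0$ and either $x$ ends at the last letter of $w$ or $x$ is immediately followed in $w$ by the letter $1$. For a movable subpath $x$, let $N=N(w,x)\geq 1$ be the number of consecutive letters $0$ just before $x$, so $w=a\,0^{N}\,x\,b$ where $a$ does not end with $0$; for $1\leq i\leq N$ let $M(w,x,i)=a\,0^{N-i}\,x\,0^{i}\,b\in\mathscr{D}_n$. Let $\Gamma_n$ be the directed graph on $\mathscr{D}_n$ with edges $w\to M(w,x,i)$ for all movable $x$ in $w$ and all $1\leq i\leq N(w,x)$. The dexter order is: $u\leq v$ if and only if there is a directed path (possibly of length $0$) from $u$ to $v$ in $\Gamma_n$. This is a partial order whose cover relations are exactly the edges of $\Gamma_n$. The Tamari order on $\mathscr{D}_n$ is the reflexive-transitive closure of the moves $a\,0\,x\,b\to a\,x\,0\,b$, where $x$ is a subpath (immediately preceded by a letter $0$) of the Dyck path $a\,0\,x\,b$.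 *)

theory Defs
  imports Main
begin

datatype letter = L0 | L1

definition height :: "letter list \<Rightarrow> int" where
  "height p = int (count_list p L1) - int (count_list p L0)"

definition dyck_paths :: "nat \<Rightarrow> letter list set" where
  "dyck_paths n = {w. length w = 2 * n \<and> count_list w L1 = n \<and> count_list w L0 = n \<and>
     (\<forall>k \<le> length w. count_list (take k w) L0 \<le> count_list (take k w) L1)}"

text \<open>
  A subpath is an occurrence of a factor in a word, so it is given by the whole
  decomposition \<open>w = p @ x @ q\<close>: the same factor \<open>x\<close> may occur at several positions of \<open>w\<close>.
\<close>

definition subpath :: "letter list \<Rightarrow> letter list \<Rightarrow> letter list \<Rightarrow> letter list \<Rightarrow> bool" where
  "subpath w p x q \<longleftrightarrow> w = p @ x @ q \<and> x \<noteq> [] \<and> height (p @ x) = height p \<and>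
     (\<forall>k. 0 < k \<and> k < length x \<longrightarrow> height (p @ take k x) > height p)"

definition movable :: "letter list \<Rightarrow> letter list \<Rightarrow> letter list \<Rightarrow> letter list \<Rightarrow> bool" where
  "movable w p x q \<longleftrightarrow> subpath w p x q \<and> p \<noteq> [] \<and> last p = L0 \<and> (q = [] \<or> hd q = L1)"

text \<open>
  The edges \<open>w \<rightarrow> M(w,x,i)\<close>. As \<open>a\<close> does not end with \<open>L0\<close>, the number \<open>N\<close> is exactly the
  length of the maximal run of letters \<open>L0\<close> just before \<open>x\<close>.
\<close>

definition dexter_graph :: "nat \<Rightarrow> (letter list \<times> letter list) set" where
  "dexter_graph n = {(w, a @ replicate (N - i) L0 @ x @ replicate i L0 @ b) | w a N i x b.
     w \<in> dyck_paths n \<and> movable w (a @ replicate N L0) x b \<and>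
     (a = [] \<or> last a \<noteq> L0) \<and> 1 \<le> i \<and> i \<le> N}"

definition dexter_le :: "nat \<Rightarrow> letter list \<Rightarrow> letter list \<Rightarrow> bool" where
  "dexter_le n u v \<longleftrightarrow>
     u \<in> dyck_paths n \<and> v \<in> dyck_paths n \<and> (u, v) \<in> (dexter_graph n)\<^sup>*"

definition tamari_moves :: "nat \<Rightarrow> (letter list \<times> letter list) set" where
  "tamari_moves n = {(w, a @ x @ [L0] @ b) | w a x b.
     w \<in> dyck_paths n \<and> subpath w (a @ [L0]) x b}"

definition tamari_le :: "nat \<Rightarrow> letter list \<Rightarrow> letter list \<Rightarrow> bool" where
  "tamari_le n u v \<longleftrightarrow>
     u \<in> dyck_paths n \<and> v \<in> dyck_paths n \<and> (u, v) \<in> (tamari_moves n)\<^sup>*"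

end

theory Submission
  imports Defs
begin

text \<open>
  Sliding \<open>x\<close> to the left across \<open>i\<close> letters \<open>0\<close>, one letter at a time, is a chain of \<open>i\<close> Tamari
  moves through Dyck paths. So every edge of the dexter graph is a chain of Tamari moves.
\<close>

lemma height_append [simp]: "height (p @ q) = height p + height q"
  by (simp add: height_def)

lemma height_L0 [simp]: "height [L0] = - 1"
  by (simp add: height_def)

text \<open>Past its length \<open>take k w\<close> is just \<open>w\<close>, so the bound on
  \<open>k\<close> can go, and later instantiations need no side condition.\<close>

lemma dyck_paths_iff:
  "w \<in> dyck_paths n \<longleftrightarrow>
     count_list w L1 = n \<and> count_list w L0 = n \<and> length w = 2 * n \<and>
     (\<forall>k. height (take k w) \<ge> 0)"
proof -
  have "(\<forall>k \<le> length w. count_list (take k w) L0 \<le> count_list (take k w) L1) \<longleftrightarrow>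
      (\<forall>k. height (take k w) \<ge> 0)"
    unfolding height_def by (metis diff_ge_0_iff_ge le_cases of_nat_le_iff order_refl take_all)
  then show ?thesis
    unfolding dyck_paths_def by auto
qed

text \<open>Heights add up, so \<open>height p\<close> cancels. The condition then concerns
  \<open>x\<close> alone, and \<open>x\<close> stays a subpath whatever surrounds it after a
  move.\<close>

lemma subpath_iff:
  "subpath w p x q \<longleftrightarrow>
     w = p @ x @ q \<and> x \<noteq> [] \<and> height x = 0 \<and> (\<forall>k. 0 < k \<and> k < length x \<longrightarrow> height (take k x) > 0)"
  by (auto simp: subpath_def)

lemma subpath_take_nonneg:
  assumes "subpath w p x q"
  shows "height (take k x) \<ge> 0"
proof (cases "0 < k \<and> k < length x")
  case False
  then have "take k x = [] \<or> take k x = x"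
    by auto
  with assms show ?thesis
    by (auto simp: subpath_iff height_def)
qed (use assms in \<open>auto simp: subpath_iff intro: less_imp_le\<close>)

lemma tamari_move_dyck:
  assumes dyck: "a @ [L0] @ x @ b \<in> dyck_paths n"
    and sub: "subpath (a @ [L0] @ x @ b) (a @ [L0]) x b"
  shows "a @ x @ [L0] @ b \<in> dyck_paths n"
proof -
  have old: "height (take k (a @ [L0] @ x @ b)) \<ge> 0" for k
    using dyck by (auto simp: dyck_paths_iff)
  have x: "height x = 0"
    using sub by (simp add: subpath_iff)
  have "height (take k (a @ x @ [L0] @ b)) \<ge> 0" for k
  proof (cases "k \<le> length a + length x")
    case True
    \<comment> \<open>The new prefix is a prefix of \<open>a\<close> followed by a prefix of
      \<open>x\<close>; both have nonnegative height.\<close>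
    have "height (take k a) \<ge> 0"
      using old[of "min k (length a)"] by (simp add: min_def split: if_splits)
    with subpath_take_nonneg[OF sub, of "k - length a"] True show ?thesis
      by simp
  next
    case False
    \<comment> \<open>Now both prefixes of length \<open>k\<close> contain all of \<open>a\<close>,
      \<open>x\<close> and the moved \<open>L0\<close>, then the same part of \<open>b\<close>; only
      the order differs, so the heights agree.\<close>
    then show ?thesis
      using old[of k] x
      by (simp add: take_Cons' height_def split: if_splits)
  qed
  with dyck show ?thesis
    by (auto simp: dyck_paths_iff)
qed

text \<open>Each move takes the \<open>L0\<close> adjacent to \<open>x\<close> to its right, where
  it joins the suffix; hence the induction generalizes \<open>b\<close>.\<close>

lemma tamari_slide:
  assumes "a @ replicate i L0 @ x @ b \<in> dyck_paths n"
    and "subpath (a @ replicate i L0 @ x @ b) (a @ replicate i L0) x b"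
  shows "(a @ replicate i L0 @ x @ b, a @ x @ replicate i L0 @ b) \<in> (tamari_moves n)\<^sup>*"
  using assms
proof (induction i arbitrary: b)
  case (Suc i)
  let ?u = "(a @ replicate i L0) @ [L0] @ x @ b"
  let ?v = "(a @ replicate i L0) @ x @ [L0] @ b"
  \<comment> \<open>\<open>replicate\<close> adds its extra letter in front; the move needs it at
    the end, next to \<open>x\<close>.\<close>
  have u: "a @ replicate (Suc i) L0 @ x @ b = ?u"
    by (simp add: replicate_app_Cons_same)
  have dyck: "?u \<in> dyck_paths n" and sub: "subpath ?u ((a @ replicate i L0) @ [L0]) x b"
    using Suc.prems unfolding u by (simp_all add: subpath_iff)
  have move: "(?u, ?v) \<in> tamari_moves n"
    unfolding tamari_moves_def using dyck sub by blast
  have "(a @ replicate i L0 @ x @ ([L0] @ b), a @ x @ replicate i L0 @ ([L0] @ b))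
      \<in> (tamari_moves n)\<^sup>*"
    by (rule Suc.IH) (use tamari_move_dyck[OF dyck sub] sub in \<open>simp_all add: subpath_iff\<close>)
  with move show ?case
    unfolding u by (simp add: replicate_app_Cons_same converse_rtrancl_into_rtrancl)
qed simp

lemma dexter_graph_subset_tamari: "dexter_graph n \<subseteq> (tamari_moves n)\<^sup>*"
proof (rule subrelI)
  fix w v
  assume "(w, v) \<in> dexter_graph n"
  then obtain a N i x b where
    v: "v = a @ replicate (N - i) L0 @ x @ replicate i L0 @ b" and
    w: "w \<in> dyck_paths n" and sub: "subpath w (a @ replicate N L0) x b" and "i \<le> N"
    unfolding dexter_graph_def movable_def by blast
  \<comment> \<open>Only the last \<open>i\<close> zeros are crossed; the first \<open>N - i\<close>
    stay put and are absorbed into the fixed prefix of \<open>tamari_slide\<close>.\<close>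
  have "replicate N L0 = replicate (N - i) L0 @ replicate i L0"
    using \<open>i \<le> N\<close> by (simp flip: replicate_add)
  then have "w = (a @ replicate (N - i) L0) @ replicate i L0 @ x @ b"
    using sub by (simp add: subpath_iff)
  with w sub v show "(w, v) \<in> (tamari_moves n)\<^sup>*"
    using tamari_slide[of "a @ replicate (N - i) L0" i x b n] by (simp add: subpath_iff)
qed

theorem proposition1p6:
  fixes n :: nat and w w' :: "letter list"
  assumes "w \<in> dyck_paths n" and "w' \<in> dyck_paths n"
    and "dexter_le n w w'"
  shows "tamari_le n w w'"
  using assms rtrancl_subset_rtrancl[OF dexter_graph_subset_tamari]
  unfolding dexter_le_def tamari_le_def by blast

end
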